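(* Let $G$ be a group. (1) Let $S$ be a commutative monoid with identity $0$, let $S_0$ be a set of generators of $S$, and let $f:S\to G$ be a polynomial map of degree $d$. Then $f$ is uniquely determined by its values on $\{0\}\cup S_0^{\le d}$; that is, any polynomial map $S\to G$ of degree $d$ agreeing with $f$ on $\{0\}\cup S_0^{\le d}$ equals $f$. (2) Let $S$ be a nonempty commutative semigroup without $0$ generated by $S_0$, and let $f:S\to G$ be a polynomial map of degree $d$. Then $f$ is uniquely determined by its values on $S_0^{\le d+1}$, in the same sense. (3) If $S$ is a finitely generated commutative monoid or semigroup and $f:S\to G$ is a polynomial map, then the subgroup of $G$ generated by the image $f(S)$ is finitely generated.
   Context: For a subset $S_0$ of a commutative semigroup and $m\in\{0,1,2,\dots\}$, $S_0^{\le m}=\{s_1+s_2+\dots+s_i \mid 1\le i\le m,\ s_1,\dots,s_i\in S_0\}$. For $m=-\infty$ this set is empty, and $-\infty+1=-\infty$. Let $S$ be a nonempty commutative semigroup (written additively) and $G$ a group with identity $1_G$. A map $f:S\to G$ is a polynomial map of degree $-\infty$ if $f(s)=1_G$ for all $s$, and of degree $0$ if it is constant with value different from $1_G$. Thus degree $\le 0$ means constant. Inductively, for $d\in\{0,1,2,\dots\}$, $f$ is a polynomial map of degree $\le d+1$ if for every $s\in S$ both maps $L_s(f):t\mapsto f(s+t)f(t)^{-1}$ and $R_s(f):t\mapsto f(t)^{-1}f(s+t)$ from $S$ to $G$ are polynomial maps of degree $\le d$. The degree of a polynomial map is the least such $d\in\{-\infty,0,1,2,\dots\}$. A map is a polynomial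 map if it is a polynomial map of degree $\le d$ for some $d$. *)

theory Defs
  imports "HOL-Algebra.Generated_Groups" "HOL-Library.Option_ord" "HOL.Hull"
begin

text \<open>
  Semigroups reuse the monoid record of HOL-Algebra, so the operation of \<open>S\<close> is written
  multiplicatively: \<open>x \<otimes>\<^bsub>S\<^esub> y\<close> stands for \<open>x + y\<close> and, if \<open>S\<close> is a monoid, \<open>\<one>\<^bsub>S\<^esub>\<close> for \<open>0\<close>.
  For a semigroup the field \<open>one\<close> of the record carries no information.
\<close>

locale comm_semigroup =
  fixes S (structure)
  assumes m_closed: "\<lbrakk>x \<in> carrier S; y \<in> carrier S\<rbrakk> \<Longrightarrow> x \<otimes> y \<in> carrier S"
    and m_assoc: "\<lbrakk>x \<in> carrier S; y \<in> carrier S; z \<in> carrier S\<rbrakk> \<Longrightarrow> (x \<otimes> y) \<otimes> z = x \<otimes> (y \<otimes> z)"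
    and m_comm: "\<lbrakk>x \<in> carrier S; y \<in> carrier S\<rbrakk> \<Longrightarrow> x \<otimes> y = y \<otimes> x"

lemma (in comm_monoid) comm_semigroup: "comm_semigroup G"
  by unfold_locales (simp_all add: m_assoc, simp add: m_comm)

definition has_identity :: "('s, 'm) monoid_scheme \<Rightarrow> bool" where
  "has_identity S \<longleftrightarrow> (\<exists>e\<in>carrier S. \<forall>x\<in>carrier S. e \<otimes>\<^bsub>S\<^esub> x = x \<and> x \<otimes>\<^bsub>S\<^esub> e = x)"

definition subsemigroup :: "'s set \<Rightarrow> ('s, 'm) monoid_scheme \<Rightarrow> bool" where
  "subsemigroup H S \<longleftrightarrow> H \<subseteq> carrier S \<and> (\<forall>x\<in>H. \<forall>y\<in>H. x \<otimes>\<^bsub>S\<^esub> y \<in> H)"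

definition monoid_generators :: "('s, 'm) monoid_scheme \<Rightarrow> 's set \<Rightarrow> bool" where
  "monoid_generators S S0 \<longleftrightarrow> S0 \<subseteq> carrier S \<and> (\<lambda>H. submonoid H S) hull S0 = carrier S"

definition semigroup_generators :: "('s, 'm) monoid_scheme \<Rightarrow> 's set \<Rightarrow> bool" where
  "semigroup_generators S S0 \<longleftrightarrow> S0 \<subseteq> carrier S \<and> (\<lambda>H. subsemigroup H S) hull S0 = carrier S"

text \<open>
  Degrees live in \<open>{-\<infinity>, 0, 1, 2, \<dots>}\<close>, encoded as \<^typ>\<open>nat option\<close> with \<^term>\<open>None\<close> for \<open>-\<infinity>\<close>;
  the order is the one in which \<^term>\<open>None\<close> is the bottom element. Accordingly \<open>d + 1\<close> is
  \<^term>\<open>map_option Suc d\<close>.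
\<close>

fun sums_le :: "('s, 'm) monoid_scheme \<Rightarrow> 's set \<Rightarrow> nat option \<Rightarrow> 's set" where
  "sums_le S S0 None = {}"
| "sums_le S S0 (Some m) =
    {foldl (\<otimes>\<^bsub>S\<^esub>) x xs | x xs. x \<in> S0 \<and> set xs \<subseteq> S0 \<and> length (x # xs) \<le> m}"

definition Lop :: "('s, 'm) monoid_scheme \<Rightarrow> ('g, 'n) monoid_scheme \<Rightarrow> 's \<Rightarrow> ('s \<Rightarrow> 'g) \<Rightarrow> 's \<Rightarrow> 'g" where
  "Lop S G s f = (\<lambda>t. f (s \<otimes>\<^bsub>S\<^esub> t) \<otimes>\<^bsub>G\<^esub> inv\<^bsub>G\<^esub> (f t))"

definition Rop :: "('s, 'm) monoid_scheme \<Rightarrow> ('g, 'n) monoid_scheme \<Rightarrow> 's \<Rightarrow> ('s \<Rightarrow> 'g) \<Rightarrow> 's \<Rightarrow> 'g" where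
  "Rop S G s f = (\<lambda>t. inv\<^bsub>G\<^esub> (f t) \<otimes>\<^bsub>G\<^esub> f (s \<otimes>\<^bsub>S\<^esub> t))"

fun poly_map_le ::
  "('s, 'm) monoid_scheme \<Rightarrow> ('g, 'n) monoid_scheme \<Rightarrow> nat option \<Rightarrow> ('s \<Rightarrow> 'g) \<Rightarrow> bool" where
  "poly_map_le S G None f \<longleftrightarrow>
     f \<in> carrier S \<rightarrow> carrier G \<and> (\<forall>s\<in>carrier S. f s = \<one>\<^bsub>G\<^esub>)"
| "poly_map_le S G (Some 0) f \<longleftrightarrow>
     f \<in> carrier S \<rightarrow> carrier G \<and> (\<exists>c\<in>carrier G. \<forall>s\<in>carrier S. f s = c)"
| "poly_map_le S G (Some (Suc d)) f \<longleftrightarrow>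
     f \<in> carrier S \<rightarrow> carrier G \<and>
     (\<forall>s\<in>carrier S. poly_map_le S G (Some d) (Lop S G s f) \<and> poly_map_le S G (Some d) (Rop S G s f))"

definition poly_map :: "('s, 'm) monoid_scheme \<Rightarrow> ('g, 'n) monoid_scheme \<Rightarrow> ('s \<Rightarrow> 'g) \<Rightarrow> bool" where
  "poly_map S G f \<longleftrightarrow> (\<exists>d. poly_map_le S G d f)"

definition poly_degree :: "('s, 'm) monoid_scheme \<Rightarrow> ('g, 'n) monoid_scheme \<Rightarrow> ('s \<Rightarrow> 'g) \<Rightarrow> nat option" where
  "poly_degree S G f = (LEAST d. poly_map_le S G d f)"

definition poly_map_of_degree ::
  "('s, 'm) monoid_scheme \<Rightarrow> ('g, 'n) monoid_scheme \<Rightarrow> nat option \<Rightarrow> ('s \<Rightarrow> 'g) \<Rightarrow> bool" where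
  "poly_map_of_degree S G d f \<longleftrightarrow> poly_map S G f \<and> poly_degree S G f = d"

lemma poly_map_of_degreeD:
  assumes "poly_map_of_degree S G d f"
  shows "poly_map_le S G d f"
  using assms unfolding poly_map_of_degree_def poly_map_def poly_degree_def
  by (auto intro: LeastI)

lemma poly_map_of_degree_None_iff:
  "poly_map_of_degree S G None f \<longleftrightarrow>
     f \<in> carrier S \<rightarrow> carrier G \<and> (\<forall>s\<in>carrier S. f s = \<one>\<^bsub>G\<^esub>)"
proof
  assume "f \<in> carrier S \<rightarrow> carrier G \<and> (\<forall>s\<in>carrier S. f s = \<one>\<^bsub>G\<^esub>)"
  then have "poly_map_le S G None f" by simp
  then show "poly_map_of_degree S G None f"
    unfolding poly_map_of_degree_def poly_map_def poly_degree_def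
    by (intro conjI exI[of _ None] Least_equality) (auto simp: less_eq_option_None)
qed (drule poly_map_of_degreeD, simp)

lemma poly_map_of_degree_0_iff:
  assumes "carrier S \<noteq> {}"
  shows "poly_map_of_degree S G (Some 0) f \<longleftrightarrow>
     (\<exists>c\<in>carrier G. c \<noteq> \<one>\<^bsub>G\<^esub> \<and> (\<forall>s\<in>carrier S. f s = c))"
proof
  assume L: "poly_map_of_degree S G (Some 0) f"
  then obtain c where c: "c \<in> carrier G" "\<forall>s\<in>carrier S. f s = c"
    using poly_map_of_degreeD[OF L] by auto
  have "\<not> poly_map_of_degree S G None f"
    using L by (auto simp: poly_map_of_degree_def)
  then have "c \<noteq> \<one>\<^bsub>G\<^esub>"
    using c by (auto simp: poly_map_of_degree_None_iff)
  with c show "\<exists>c\<in>carrier G. c \<noteq> \<one>\<^bsub>G\<^esub> \<and> (\<forall>s\<in>carrier S. f s = c)" by blast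
next
  assume "\<exists>c\<in>carrier G. c \<noteq> \<one>\<^bsub>G\<^esub> \<and> (\<forall>s\<in>carrier S. f s = c)"
  then obtain c where c: "c \<in> carrier G" "c \<noteq> \<one>\<^bsub>G\<^esub>" "\<forall>s\<in>carrier S. f s = c" by blast
  then have 0: "poly_map_le S G (Some 0) f" by auto
  have "\<not> poly_map_le S G None f" using c assms by auto
  then have le: "Some 0 \<le> d" if "poly_map_le S G d f" for d
    using that by (cases d) auto
  from 0 show "poly_map_of_degree S G (Some 0) f"
    unfolding poly_map_of_degree_def poly_map_def poly_degree_def
    using le by (intro conjI exI[of _ "Some 0"] Least_equality)
qed

definition fg_monoid :: "('s, 'm) monoid_scheme \<Rightarrow> bool" where
  "fg_monoid S \<longleftrightarrow> (\<exists>S0. finite S0 \<and> monoid_generators S S0)"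

definition fg_semigroup :: "('s, 'm) monoid_scheme \<Rightarrow> bool" where
  "fg_semigroup S \<longleftrightarrow> (\<exists>S0. finite S0 \<and> semigroup_generators S S0)"

definition fg_subgroup :: "('g, 'n) monoid_scheme \<Rightarrow> 'g set \<Rightarrow> bool" where
  "fg_subgroup G H \<longleftrightarrow> subgroup H G \<and> (\<exists>A. finite A \<and> A \<subseteq> H \<and> generate G A = H)"

end

theory Submission
  imports Defs
begin

text \<open>
  Everything rests on the identity \<open>f (s + t) = L\<^sub>s(f)(t) f(t)\<close>, which recovers \<open>f\<close> along
  translations by a generator \<open>s\<close> from its values on some starting set and from the map \<open>L\<^sub>s(f)\<close>
  of smaller degree. If \<open>f\<close> is known on all sums of at most \<open>m + 1\<close> generators, then \<open>L\<^sub>s(f)\<close> is known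
  on all sums of at most \<open>m\<close> generators, so an induction on the degree applies. The starting set
  is \<open>{0}\<close> in a monoid and \<open>S\<^sub>0\<close> in a semigroup, which accounts for the two different bounds in the
  uniqueness statements.

  Uniqueness and finite generation are two instances of one statement
  (\<open>test_sets.pair_mem_subgroup\<close>): if \<open>f\<close> and \<open>g\<close> have degree at most \<open>d\<close> and the pair \<open>(f, g)\<close>
  takes values in a subgroup \<open>K\<close> of \<open>G \<times> G\<close> on the test set for degree \<open>d\<close>, then it does so on all
  of \<open>S\<close>. When \<open>K\<close> is the diagonal this is uniqueness. When \<open>g = f\<close> and \<open>K = H \<times> H\<close>, where \<open>H\<close> is
  generated by the values of \<open>f\<close> on the test set, it says that \<open>f\<close> takes all its values in \<open>H\<close>; and
  the test set is finite if there are finitely many generators.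
\<close>

section \<open>Determination by values on test sets\<close>

text \<open>
  The properties of the test sets \<open>{0} \<union> S\<^sub>0\<^bsup>\<le>d\<^esup>\<close> (monoids) and \<open>S\<^sub>0\<^bsup>\<le>d+1\<^esup>\<close> (semigroups) on which
  the induction on the degree depends. The last one expresses that translations by \<open>S0\<close> lead from
  \<open>T 0\<close> to every element of \<open>S\<close>.
\<close>

locale test_sets =
  fixes S :: "('s, 'm) monoid_scheme" (structure) and S0 :: "'s set" and T :: "nat \<Rightarrow> 's set"
  assumes closed: "\<lbrakk>x \<in> carrier S; y \<in> carrier S\<rbrakk> \<Longrightarrow> x \<otimes> y \<in> carrier S"
    and generators_subset: "S0 \<subseteq> carrier S"
    and test_subset: "T d \<subseteq> carrier S"
    and test_mono: "d \<le> e \<Longrightarrow> T d \<subseteq> T e"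
    and test_step: "\<lbrakk>s \<in> S0; x \<in> T d\<rbrakk> \<Longrightarrow> s \<otimes> x \<in> T (Suc d)"
    and translation_induct:
      "\<lbrakk>x \<in> carrier S; \<And>x. x \<in> T 0 \<Longrightarrow> P x;
        \<And>s x. \<lbrakk>s \<in> S0; x \<in> carrier S; P x\<rbrakk> \<Longrightarrow> P (s \<otimes> x)\<rbrakk> \<Longrightarrow> P x"

lemma poly_map_le_into: "poly_map_le S G d f \<Longrightarrow> f \<in> carrier S \<rightarrow> carrier G"
  by (induction S G d f rule: poly_map_le.induct) auto

lemma (in group) Lop_mult_cancel:
  assumes "f \<in> carrier S \<rightarrow> carrier G" "x \<in> carrier S" "s \<otimes>\<^bsub>S\<^esub> x \<in> carrier S"
  shows "Lop S G s f x \<otimes> f x = f (s \<otimes>\<^bsub>S\<^esub> x)"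
proof -
  have "f x \<in> carrier G" "f (s \<otimes>\<^bsub>S\<^esub> x) \<in> carrier G" using assms by auto
  then show ?thesis by (simp add: Lop_def m_assoc)
qed

text \<open>
  For the induction step, \<open>K\<close> contains the values of \<open>(L\<^sub>s(f), L\<^sub>s(g))\<close> on \<open>T d\<close> because it is closed
  under products and inverses, hence all values of this pair by the induction hypothesis. So the set
  where \<open>(f, g)\<close> takes values in \<open>K\<close> is stable under translation by generators.
\<close>

lemma (in test_sets) pair_mem_subgroup:
  assumes "group G" and K: "subgroup K (G \<times>\<times> G)"
    and "poly_map_le S G (Some d) f" "poly_map_le S G (Some d) g"
    and "\<And>x. x \<in> T d \<Longrightarrow> (f x, g x) \<in> K"
    and "x \<in> carrier S"
  shows "(f x, g x) \<in> K"
proof -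
  interpret group G by fact
  have mult: "(a \<otimes>\<^bsub>G\<^esub> a', b \<otimes>\<^bsub>G\<^esub> b') \<in> K" if "(a, b) \<in> K" "(a', b') \<in> K" for a b a' b'
    using subgroup.m_closed[OF K that] by simp
  have inverse: "(inv\<^bsub>G\<^esub> a, inv\<^bsub>G\<^esub> b) \<in> K" if "(a, b) \<in> K" for a b
    using subgroup.m_inv_closed[OF K that] subgroup.mem_carrier[OF K that]
    by (simp add: inv_DirProd[OF \<open>group G\<close> \<open>group G\<close>])
  show ?thesis using assms(3-)
  proof (induction d arbitrary: f g x)
    case 0
    (* Constant maps are invariant under translation. *)
    from \<open>x \<in> carrier S\<close> show ?case
    proof (rule translation_induct)
      fix s x assume "s \<in> S0" "x \<in> carrier S" "(f x, g x) \<in> K"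
      moreover from this have "s \<otimes> x \<in> carrier S"
        using closed generators_subset by blast
      ultimately show "(f (s \<otimes> x), g (s \<otimes> x)) \<in> K"
        using 0(1,2) by auto
    qed (rule 0(3))
  next
    case (Suc d)
    note into = poly_map_le_into[OF Suc.prems(1)] poly_map_le_into[OF Suc.prems(2)]
    have differences: "(Lop S G s f y, Lop S G s g y) \<in> K" if s: "s \<in> S0" and y: "y \<in> carrier S" for s y
    proof (rule Suc.IH)
      show "poly_map_le S G (Some d) (Lop S G s f)" "poly_map_le S G (Some d) (Lop S G s g)"
        using Suc.prems(1,2) s generators_subset by auto
      show "(Lop S G s f t, Lop S G s g t) \<in> K" if "t \<in> T d" for t
      proof -
        have "t \<in> T (Suc d)" "s \<otimes> t \<in> T (Suc d)"
          using test_mono[of d "Suc d"] test_step[OF s] that by auto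
        then show ?thesis
          unfolding Lop_def by (intro mult inverse Suc.prems(3))
      qed
    qed (rule y)
    from \<open>x \<in> carrier S\<close> show ?case
    proof (rule translation_induct)
      show "(f y, g y) \<in> K" if "y \<in> T 0" for y
        using that test_mono[of 0 "Suc d"] Suc.prems(3) by auto
      fix s y assume y: "s \<in> S0" "y \<in> carrier S" "(f y, g y) \<in> K"
      then have "s \<otimes> y \<in> carrier S"
        using closed generators_subset by blast
      then show "(f (s \<otimes> y), g (s \<otimes> y)) \<in> K"
        using mult[OF differences[OF y(1,2)] y(3)] y(2) into by (simp add: Lop_mult_cancel)
    qed
  qed
qed

lemma (in test_sets) poly_map_eqI:
  assumes "group G" and f: "poly_map_le S G (Some d) f" and g: "poly_map_le S G (Some d) g"
    and agree: "\<And>x. x \<in> T d \<Longrightarrow> g x = f x" and x: "x \<in> carrier S"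
  shows "g x = f x"
proof -
  interpret group G by fact
  let ?D = "{(a, a) | a. a \<in> carrier G}"
  interpret GG: group "G \<times>\<times> G" by (rule DirProd_group) fact+
  have "subgroup ?D (G \<times>\<times> G)"
  proof (rule GG.subgroupI)
    show "inv\<^bsub>G \<times>\<times> G\<^esub> p \<in> ?D" if "p \<in> ?D" for p
      using that by (auto simp: inv_DirProd[OF \<open>group G\<close> \<open>group G\<close>])
  qed auto
  moreover have "(f y, g y) \<in> ?D" if "y \<in> T d" for y
    using that agree poly_map_le_into[OF f] test_subset by auto
  ultimately have "(f x, g x) \<in> ?D"
    by (rule pair_mem_subgroup[OF \<open>group G\<close> _ f g _ x])
  then show ?thesis by auto
qed

lemma (in test_sets) fg_subgroup_generate_image:
  assumes "group G" and f: "poly_map_le S G (Some d) f" and fin: "finite (T d)"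
  shows "fg_subgroup G (generate G (f ` carrier S))"
proof -
  interpret group G by fact
  let ?H = "generate G (f ` T d)"
  have im: "f ` carrier S \<subseteq> carrier G" using poly_map_le_into[OF f] by auto
  then have imT: "f ` T d \<subseteq> carrier G" using test_subset by blast
  have H: "subgroup ?H G" by (rule generate_is_subgroup[OF imT])
  have "(f x, f x) \<in> ?H \<times> ?H" if "x \<in> carrier S" for x
    by (rule pair_mem_subgroup[OF \<open>group G\<close> DirProd_subgroups[OF \<open>group G\<close> H \<open>group G\<close> H] f f _ that])
      (auto intro: generate.incl)
  then have "generate G (f ` carrier S) \<subseteq> ?H"
    by (intro generate_subgroup_incl[OF _ H]) auto
  moreover have "?H \<subseteq> generate G (f ` carrier S)"
    using test_subset by (intro mono_generate image_mono)
  moreover have "f ` T d \<subseteq> generate G (f ` carrier S)"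
    using test_subset by (auto intro!: generate.incl)
  ultimately show ?thesis
    unfolding fg_subgroup_def using fin generate_is_subgroup[OF im]
    by (intro conjI exI[of _ "f ` T d"]) auto
qed

section \<open>Sums of boundedly many generators\<close>

lemma (in comm_semigroup) foldl_closed:
  "\<lbrakk>x \<in> carrier S; set xs \<subseteq> carrier S\<rbrakk> \<Longrightarrow> foldl (\<otimes>) x xs \<in> carrier S"
  by (induction xs arbitrary: x) (auto simp: m_closed)

lemma (in comm_semigroup) mult_foldl:
  "\<lbrakk>s \<in> carrier S; x \<in> carrier S; set xs \<subseteq> carrier S\<rbrakk>
    \<Longrightarrow> s \<otimes> foldl (\<otimes>) x xs = foldl (\<otimes>) (s \<otimes> x) xs"
  by (induction xs arbitrary: x) (auto simp: m_closed m_assoc)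

lemma (in comm_semigroup) sums_le_subset:
  "S0 \<subseteq> carrier S \<Longrightarrow> sums_le S S0 (Some m) \<subseteq> carrier S"
  by (auto intro!: foldl_closed)

lemma sums_le_mono: "m \<le> n \<Longrightarrow> sums_le S S0 (Some m) \<subseteq> sums_le S S0 (Some n)"
  unfolding sums_le.simps by (blast intro: le_trans)

lemma generators_subset_sums_le: "S0 \<subseteq> sums_le S S0 (Some (Suc m))"
proof
  fix x assume "x \<in> S0"
  then show "x \<in> sums_le S S0 (Some (Suc m))"
    unfolding sums_le.simps by (intro CollectI exI[of _ x] exI[of _ "[]"]) simp
qed

lemma sums_le_1: "sums_le S S0 (Some (Suc 0)) = S0"
  by auto

lemma (in comm_semigroup) sums_le_step:
  assumes "S0 \<subseteq> carrier S" "s \<in> S0" "y \<in> sums_le S S0 (Some m)"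
  shows "s \<otimes> y \<in> sums_le S S0 (Some (Suc m))"
proof -
  obtain x xs where y: "y = foldl (\<otimes>) x xs" "x \<in> S0" "set xs \<subseteq> S0" "length (x # xs) \<le> m"
    using assms(3) by auto
  then have "s \<otimes> y = foldl (\<otimes>) s (x # xs)"
    using assms mult_foldl[of s x xs] by auto
  with y assms(2) show ?thesis
    unfolding sums_le.simps by (intro CollectI exI[of _ s] exI[of _ "x # xs"]) simp
qed

lemma finite_sums_le:
  assumes "finite S0"
  shows "finite (sums_le S S0 (Some m))"
proof (rule finite_subset)
  let ?L = "{xs. set xs \<subseteq> S0 \<and> length xs \<le> m}"
  show "sums_le S S0 (Some m) \<subseteq> (\<lambda>(x, xs). foldl (\<otimes>\<^bsub>S\<^esub>) x xs) ` (S0 \<times> ?L)"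
  proof
    fix y assume "y \<in> sums_le S S0 (Some m)"
    then obtain x xs where "y = foldl (\<otimes>\<^bsub>S\<^esub>) x xs" "(x, xs) \<in> S0 \<times> ?L" by auto
    then show "y \<in> (\<lambda>(x, xs). foldl (\<otimes>\<^bsub>S\<^esub>) x xs) ` (S0 \<times> ?L)" by (auto intro: rev_image_eqI)
  qed
  show "finite ((\<lambda>(x, xs). foldl (\<otimes>\<^bsub>S\<^esub>) x xs) ` (S0 \<times> ?L))"
    using assms by (intro finite_imageI finite_cartesian_product finite_lists_length_le)
qed

section \<open>Induction along translations by generators\<close>

text \<open>
  The elements whose translation preserves \<open>P\<close> form a submonoid. If it contains the generators, then
  every \<open>x\<close> belongs to it, and \<open>P\<close> passes from \<open>0\<close> to \<open>x + 0\<close>.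
\<close>

lemma (in comm_monoid) monoid_translation_induct:
  assumes gen: "monoid_generators G S0" and x: "x \<in> carrier G" and one: "P \<one>"
    and step: "\<And>s x. \<lbrakk>s \<in> S0; x \<in> carrier G; P x\<rbrakk> \<Longrightarrow> P (s \<otimes> x)"
  shows "P x"
proof -
  let ?H = "{z \<in> carrier G. \<forall>y \<in> carrier G. P y \<longrightarrow> P (z \<otimes> y)}"
  have "S0 \<subseteq> ?H" using gen step by (auto simp: monoid_generators_def)
  moreover have "submonoid ?H G"
    by unfold_locales (auto simp: m_assoc)
  ultimately have "(\<lambda>H. submonoid H G) hull S0 \<subseteq> ?H" by (rule hull_minimal)
  then have "x \<in> ?H" using gen x by (auto simp: monoid_generators_def)
  then have "P (x \<otimes> \<one>)" using one by blast
  with x show ?thesis by simp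
qed

text \<open>
  In the absence of \<open>0\<close> there is no element to translate from, so \<open>P\<close> itself is made part of the
  subsemigroup.
\<close>

lemma (in comm_semigroup) semigroup_translation_induct:
  assumes gen: "semigroup_generators S S0" and x: "x \<in> carrier S"
    and base: "\<And>s. s \<in> S0 \<Longrightarrow> P s"
    and step: "\<And>s x. \<lbrakk>s \<in> S0; x \<in> carrier S; P x\<rbrakk> \<Longrightarrow> P (s \<otimes> x)"
  shows "P x"
proof -
  let ?H = "{z \<in> carrier S. P z \<and> (\<forall>y \<in> carrier S. P y \<longrightarrow> P (z \<otimes> y))}"
  have "S0 \<subseteq> ?H" using gen base step by (auto simp: semigroup_generators_def)
  moreover have "subsemigroup ?H S"
    unfolding subsemigroup_def by (auto simp: m_assoc m_closed)
  ultimately have "(\<lambda>H. subsemigroup H S) hull S0 \<subseteq> ?H" by (rule hull_minimal)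
  then show ?thesis using gen x by (auto simp: semigroup_generators_def)
qed

section \<open>Test sets for monoids and semigroups\<close>

lemma (in comm_monoid) monoid_test_sets:
  assumes gen: "monoid_generators G S0"
  shows "test_sets G S0 (\<lambda>d. {\<one>} \<union> sums_le G S0 (Some d))"
proof -
  interpret semi: comm_semigroup G by (rule comm_semigroup)
  have S0: "S0 \<subseteq> carrier G" using gen by (simp add: monoid_generators_def)
  show ?thesis
  proof
    fix x y d e s P
    show "\<lbrakk>x \<in> carrier G; y \<in> carrier G\<rbrakk> \<Longrightarrow> x \<otimes> y \<in> carrier G" by simp
    show "S0 \<subseteq> carrier G" by fact
    show "{\<one>} \<union> sums_le G S0 (Some d) \<subseteq> carrier G"
      using semi.sums_le_subset[OF S0] by blast
    show "{\<one>} \<union> sums_le G S0 (Some d) \<subseteq> {\<one>} \<union> sums_le G S0 (Some e)" if "d \<le> e"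
      using that by (intro Un_mono subset_refl sums_le_mono)
    show "s \<otimes> x \<in> {\<one>} \<union> sums_le G S0 (Some (Suc d))"
      if s: "s \<in> S0" and x: "x \<in> {\<one>} \<union> sums_le G S0 (Some d)"
    proof (cases "x = \<one>")
      case True
      then have "s \<otimes> x = s" using s S0 by auto
      then show ?thesis using s generators_subset_sums_le[of S0 G d] by (simp del: sums_le.simps add: subset_iff)
    next
      case False
      then show ?thesis using x semi.sums_le_step[OF S0 s, of x d] by blast
    qed
    show "P x" if "x \<in> carrier G" and "\<And>x. x \<in> {\<one>} \<union> sums_le G S0 (Some 0) \<Longrightarrow> P x"
      and "\<And>s x. \<lbrakk>s \<in> S0; x \<in> carrier G; P x\<rbrakk> \<Longrightarrow> P (s \<otimes> x)"
      using gen that by (intro monoid_translation_induct[of S0 x P]) auto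
  qed
qed

lemma (in comm_semigroup) semigroup_test_sets:
  assumes gen: "semigroup_generators S S0"
  shows "test_sets S S0 (\<lambda>d. sums_le S S0 (Some (Suc d)))"
proof -
  have S0: "S0 \<subseteq> carrier S" using gen by (simp add: semigroup_generators_def)
  show ?thesis
  proof
    fix x y d e s P
    show "\<lbrakk>x \<in> carrier S; y \<in> carrier S\<rbrakk> \<Longrightarrow> x \<otimes> y \<in> carrier S" by (rule m_closed)
    show "S0 \<subseteq> carrier S" by fact
    show "sums_le S S0 (Some (Suc d)) \<subseteq> carrier S" by (rule sums_le_subset[OF S0])
    show "sums_le S S0 (Some (Suc d)) \<subseteq> sums_le S S0 (Some (Suc e))" if "d \<le> e"
      using that by (intro sums_le_mono) simp
    show "s \<otimes> x \<in> sums_le S S0 (Some (Suc (Suc d)))"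
      if "s \<in> S0" "x \<in> sums_le S S0 (Some (Suc d))"
      by (rule sums_le_step[OF S0 that])
    show "P x" if "x \<in> carrier S" and "\<And>x. x \<in> sums_le S S0 (Some (Suc 0)) \<Longrightarrow> P x"
      and "\<And>s x. \<lbrakk>s \<in> S0; x \<in> carrier S; P x\<rbrakk> \<Longrightarrow> P (s \<otimes> x)"
      using that unfolding sums_le_1 by (rule semigroup_translation_induct[OF gen])
  qed
qed

section \<open>Uniqueness and finite generation\<close>

lemma poly_map_obtain_nat_degree:
  assumes "group G" "poly_map S G f"
  obtains d where "poly_map_le S G (Some d) f"
proof -
  interpret group G by fact
  obtain d where d: "poly_map_le S G d f" using assms(2) by (auto simp: poly_map_def)
  show thesis
  proof (cases d)
    case None
    with d have "poly_map_le S G (Some 0) f" by auto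
    then show thesis by (rule that)
  qed (use d that in auto)
qed

theorem proposition2:
  fixes G :: "('g, 'n) monoid_scheme"
  assumes "group G"
  shows
    "(\<forall>(S :: ('s, 'm) monoid_scheme) S0 d f g.
        comm_monoid S \<and> monoid_generators S S0 \<and>
        poly_map_of_degree S G d f \<and> poly_map_of_degree S G d g \<and>
        (\<forall>x \<in> {\<one>\<^bsub>S\<^esub>} \<union> sums_le S S0 d. g x = f x)
        \<longrightarrow> (\<forall>x \<in> carrier S. g x = f x))
   \<and> (\<forall>(S :: ('s, 'm) monoid_scheme) S0 d f g.
        comm_semigroup S \<and> carrier S \<noteq> {} \<and> \<not> has_identity S \<and> semigroup_generators S S0 \<and>
        poly_map_of_degree S G d f \<and> poly_map_of_degree S G d g \<and>
        (\<forall>x \<in> sums_le S S0 (map_option Suc d). g x = f x)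
        \<longrightarrow> (\<forall>x \<in> carrier S. g x = f x))
   \<and> (\<forall>(S :: ('s, 'm) monoid_scheme) f.
        (comm_monoid S \<and> fg_monoid S \<or> comm_semigroup S \<and> carrier S \<noteq> {} \<and> fg_semigroup S) \<and>
        poly_map S G f
        \<longrightarrow> fg_subgroup G (generate G (f ` carrier S)))"
proof (intro conjI allI impI; (elim conjE)?)
  fix S :: "('s, 'm) monoid_scheme" and S0 d f g
  assume S: "comm_monoid S" "monoid_generators S S0"
    and f: "poly_map_of_degree S G d f" and g: "poly_map_of_degree S G d g"
    and agree: "\<forall>x \<in> {\<one>\<^bsub>S\<^esub>} \<union> sums_le S S0 d. g x = f x"
  show "\<forall>x \<in> carrier S. g x = f x"
  proof (cases d)
    case None
    then show ?thesis using f g by (auto simp: poly_map_of_degree_None_iff)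
  next
    case (Some n)
    with f g agree show ?thesis
      using test_sets.poly_map_eqI[OF comm_monoid.monoid_test_sets[OF S] assms, of n f g]
      by (blast dest: poly_map_of_degreeD)
  qed
next
  fix S :: "('s, 'm) monoid_scheme" and S0 d f g
  assume S: "comm_semigroup S" "semigroup_generators S S0"
    and f: "poly_map_of_degree S G d f" and g: "poly_map_of_degree S G d g"
    and agree: "\<forall>x \<in> sums_le S S0 (map_option Suc d). g x = f x"
  show "\<forall>x \<in> carrier S. g x = f x"
  proof (cases d)
    case None
    then show ?thesis using f g by (auto simp: poly_map_of_degree_None_iff)
  next
    case (Some n)
    with agree have "\<And>x. x \<in> sums_le S S0 (Some (Suc n)) \<Longrightarrow> g x = f x"
      by (metis option.map(2))
    with f g Some show ?thesis
      using test_sets.poly_map_eqI[OF comm_semigroup.semigroup_test_sets[OF S] assms, of n f g]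
      by (blast dest: poly_map_of_degreeD)
  qed
next
  fix S :: "('s, 'm) monoid_scheme" and f
  assume S: "comm_monoid S \<and> fg_monoid S \<or> comm_semigroup S \<and> carrier S \<noteq> {} \<and> fg_semigroup S"
    and "poly_map S G f"
  then obtain d where d: "poly_map_le S G (Some d) f"
    using assms by (elim poly_map_obtain_nat_degree)
  from S show "fg_subgroup G (generate G (f ` carrier S))"
  proof (elim disjE conjE)
    assume "comm_monoid S" "fg_monoid S"
    then obtain S0 where S0: "finite S0" "monoid_generators S S0"
      by (auto simp: fg_monoid_def)
    have "test_sets S S0 (\<lambda>d. {\<one>\<^bsub>S\<^esub>} \<union> sums_le S S0 (Some d))"
      by (rule comm_monoid.monoid_test_sets) fact+
    then show ?thesis
      using assms d
    proof (rule test_sets.fg_subgroup_generate_image)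
      show "finite ({\<one>\<^bsub>S\<^esub>} \<union> sums_le S S0 (Some d))"
        using finite_sums_le[OF S0(1), of S d] by blast
    qed
  next
    assume "comm_semigroup S" "fg_semigroup S"
    then obtain S0 where S0: "finite S0" "semigroup_generators S S0"
      by (auto simp: fg_semigroup_def)
    have "test_sets S S0 (\<lambda>d. sums_le S S0 (Some (Suc d)))"
      by (rule comm_semigroup.semigroup_test_sets) fact+
    then show ?thesis
      using assms d finite_sums_le[OF S0(1)] by (rule test_sets.fg_subgroup_generate_image)
  qed
qed

end
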